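(* Let $\mathcal{X}$ be a real normed linear space, $\varphi_1,\ldots,\varphi_n\in\mathcal{X}^*$, $\Phi:\mathcal{X}\to\mathbb{R}^n$, $\Phi(f)=(\varphi_1(f),\ldots,\varphi_n(f))$, and let $\mathbb{R}^n$ carry an inner product $\langle\cdot,\cdot\rangle_{\mathbb{R}^n}$. Let $\psi_1,\ldots,\psi_k\in\mathcal{X}^*$ be linearly independent with $\mathrm{span}\{\psi_1,\ldots,\psi_k\}=\mathrm{span}\{\varphi_1,\ldots,\varphi_n\}$, let $h_1,\ldots,h_k\in\mathcal{X}$ satisfy $\psi_i(h_j)=\delta_{ij}$ for $i,j\in\{1,\ldots,k\}$, and let $\mathcal{X}_0=\mathrm{span}\{h_1,\ldots,h_k\}$. Let $\xi\in\mathbb{R}^n$. Then the equation $\Phi(f)=\xi$ has a unique least-square solution in $\mathcal{X}_0$, that is, there exists a unique $f^\dagger\in\mathcal{X}_0$ such that $$\Phi^*\Phi(f^\dagger)=\Phi^*(\xi).$$ Further, $f^\dagger$ is the unique least-square solution of $\Phi(f)=\xi$ in $\mathcal{X}$ such that $$\|f^\dagger\|_0=\inf\{\|f\|_0:\ f\in\mathcal{X},\ \Phi^*\Phi(f)=\Phi^*(\xi)\},$$ where $\|\cdot\|_0$ is the norm on $\mathcal{X}$ defined by $\|f\|_0=\|g\|_{\mathcal{X}}+\|h\|_{\mathcal{X}}$, $f\in\mathcal{X}$, with $(g,h)$ the unique pair in $N(\Phi)\times\mathcal{X}_0$ such that $f=g+h$.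
   Context: $\mathcal{X}^*$ is the space of continuous linear functionals on $\mathcal{X}$; $N(\Phi)=\{f\in\mathcal{X}:\Phi(f)=0\}$. The adjoint $\Phi^*:\mathbb{R}^n\to\mathcal{X}^*$ is defined by $(\Phi^*(\mathbf{u}))(f)=\langle\Phi(f),\mathbf{u}\rangle_{\mathbb{R}^n}$ for $f\in\mathcal{X}$, $\mathbf{u}\in\mathbb{R}^n$, and $\Phi^*\Phi$ is the composition. A least-square solution of $\Phi(f)=\xi$ is an $f\in\mathcal{X}$ with $\|\Phi(f)-\xi\|_{\mathbb{R}^n}=\inf_{h\in\mathcal{X}}\|\Phi(h)-\xi\|_{\mathbb{R}^n}$, where $\|\cdot\|_{\mathbb{R}^n}$ is the norm induced by $\langle\cdot,\cdot\rangle_{\mathbb{R}^n}$; equivalently, an $f\in\mathcal{X}$ with $\Phi^*\Phi(f)=\Phi^*(\xi)$. One has $\mathcal{X}=N(\Phi)\oplus\mathcal{X}_0$ (algebraic direct sum), so the pair $(g,h)$ is well defined. *)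

theory Defs
  imports "HOL-Analysis.Analysis"
begin

definition is_inner_product :: "('v::real_vector \<Rightarrow> 'v \<Rightarrow> real) \<Rightarrow> bool" where
  "is_inner_product ip \<longleftrightarrow>
     bilinear ip \<and> (\<forall>u v. ip u v = ip v u) \<and> (\<forall>u. u \<noteq> 0 \<longrightarrow> ip u u > 0)"

definition norm_ip :: "('v::real_vector \<Rightarrow> 'v \<Rightarrow> real) \<Rightarrow> 'v \<Rightarrow> real" where
  "norm_ip ip u = sqrt (ip u u)"

definition Phi :: "('n::finite \<Rightarrow> ('a::real_normed_vector \<Rightarrow>\<^sub>L real)) \<Rightarrow> 'a \<Rightarrow> real ^ 'n" where
  "Phi \<phi> f = (\<chi> i. blinfun_apply (\<phi> i) f)"

definition null_space :: "('a \<Rightarrow> 'b::zero) \<Rightarrow> 'a set" where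
  "null_space T = {f. T f = 0}"

text \<open>\<open>Blinfun\<close> is unspecified on maps that are not bounded linear; lemma \<open>adj_map_apply\<close>
  shows that this does not happen for \<open>T = Phi \<phi>\<close>.\<close>

definition adj_map ::
  "('v \<Rightarrow> 'v \<Rightarrow> real) \<Rightarrow> ('a::real_normed_vector \<Rightarrow> 'v) \<Rightarrow> 'v \<Rightarrow> ('a \<Rightarrow>\<^sub>L real)" where
  "adj_map ip T u = Blinfun (\<lambda>f. ip (T f) u)"

definition least_square_solution ::
  "('v::real_vector \<Rightarrow> 'v \<Rightarrow> real) \<Rightarrow> ('a \<Rightarrow> 'v) \<Rightarrow> 'v \<Rightarrow> 'a \<Rightarrow> bool" where
  "least_square_solution ip T \<xi> f \<longleftrightarrow>
     norm_ip ip (T f - \<xi>) = (INF h. norm_ip ip (T h - \<xi>))"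

text \<open>Meaningful when every \<open>f\<close> has exactly one decomposition \<open>f = g + h\<close> with \<open>g \<in> N\<close> and
  \<open>h \<in> X0\<close>; see lemma \<open>direct_sum\<close>.\<close>

definition norm0 :: "'a::real_normed_vector set \<Rightarrow> 'a set \<Rightarrow> 'a \<Rightarrow> real" where
  "norm0 N X0 f =
     (let (g, h) = (THE p. p \<in> N \<times> X0 \<and> f = fst p + snd p) in norm g + norm h)"

lemma bounded_linear_Phi:
  fixes \<phi> :: "'n::finite \<Rightarrow> ('a::real_normed_vector \<Rightarrow>\<^sub>L real)"
  shows "bounded_linear (Phi \<phi>)"
proof (subst bounded_linear_componentwise_iff, intro ballI)
  fix b :: "real ^ 'n" assume "b \<in> Basis"
  have "(\<lambda>f. Phi \<phi> f \<bullet> b) = (\<lambda>f. \<Sum>i\<in>UNIV. blinfun_apply (\<phi> i) f * b $ i)"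
    by (simp add: fun_eq_iff inner_vec_def Phi_def)
  moreover have "bounded_linear (\<lambda>f. \<Sum>i\<in>UNIV. blinfun_apply (\<phi> i) f * b $ i)"
    by (intro bounded_linear_sum bounded_linear_mult_const blinfun.bounded_linear_right)
  ultimately show "bounded_linear (\<lambda>f. Phi \<phi> f \<bullet> b)" by simp
qed

lemma adj_map_apply:
  fixes ip :: "real ^ 'n::finite \<Rightarrow> real ^ 'n \<Rightarrow> real"
  assumes "is_inner_product ip"
  shows "blinfun_apply (adj_map ip (Phi \<phi>) u) f = ip (Phi \<phi> f) u"
proof -
  have "bounded_linear (\<lambda>v. ip v u)"
    using assms by (simp add: is_inner_product_def bilinear_def linear_conv_bounded_linear)
  then have "bounded_linear (\<lambda>f. ip (Phi \<phi> f) u)"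
    using bounded_linear_Phi by (rule bounded_linear_compose)
  then show ?thesis
    by (simp add: adj_map_def bounded_linear_Blinfun_apply)
qed

lemma null_space_Phi:
  fixes \<phi> :: "'n::finite \<Rightarrow> ('a::real_normed_vector \<Rightarrow>\<^sub>L real)"
  assumes "span (\<psi> ` {1..k::nat}) = span (range \<phi>)"
  shows "f \<in> null_space (Phi \<phi>) \<longleftrightarrow> (\<forall>i\<in>{1..k}. blinfun_apply (\<psi> i) f = 0)"
proof -
  have sub: "subspace {T :: 'a \<Rightarrow>\<^sub>L real. blinfun_apply T f = 0}"
    by (auto simp: subspace_def blinfun.bilinear_simps)
  have eq: "span S \<subseteq> {T. blinfun_apply T f = 0} \<longleftrightarrow> S \<subseteq> {T. blinfun_apply T f = 0}" for S :: "('a \<Rightarrow>\<^sub>L real) set"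
    using span_minimal[OF _ sub, of S] span_superset[of S] by (meson subset_trans)
  have "f \<in> null_space (Phi \<phi>) \<longleftrightarrow> range \<phi> \<subseteq> {T. blinfun_apply T f = 0}"
    by (auto simp: null_space_def Phi_def vec_eq_iff)
  also have "\<dots> \<longleftrightarrow> span (range \<phi>) \<subseteq> {T. blinfun_apply T f = 0}"
    by (rule eq[symmetric])
  also have "\<dots> \<longleftrightarrow> \<psi> ` {1..k} \<subseteq> {T. blinfun_apply T f = 0}"
    unfolding assms[symmetric] by (rule eq)
  finally show ?thesis by auto
qed

lemma span_biorthogonal:
  fixes \<psi> :: "nat \<Rightarrow> ('a::real_normed_vector \<Rightarrow>\<^sub>L real)"
  assumes bi: "\<And>i j. i \<in> {1..k} \<Longrightarrow> j \<in> {1..k} \<Longrightarrow> blinfun_apply (\<psi> i) (h j) = (if i = j then 1 else 0)"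
    and "x \<in> span (h ` {1..k})"
  shows "(\<Sum>i=1..k. blinfun_apply (\<psi> i) x *\<^sub>R h i) = x"
  using assms(2)
proof (induction rule: span_induct_alt)
  case base
  then show ?case by (simp add: blinfun.zero_right)
next
  case (step c x y)
  then obtain j where j: "j \<in> {1..k}" "x = h j" by auto
  have "(\<Sum>i=1..k. blinfun_apply (\<psi> i) x *\<^sub>R h i) = (\<Sum>i=1..k. (if i = j then h i else 0))"
    by (rule sum.cong) (auto simp: j bi[OF _ j(1)])
  also have "\<dots> = x" using j by simp
  finally have "(\<Sum>i=1..k. blinfun_apply (\<psi> i) x *\<^sub>R h i) = x" .
  moreover have "(\<Sum>i=1..k. blinfun_apply (\<psi> i) (c *\<^sub>R x + y) *\<^sub>R h i)
     = c *\<^sub>R (\<Sum>i=1..k. blinfun_apply (\<psi> i) x *\<^sub>R h i) + (\<Sum>i=1..k. blinfun_apply (\<psi> i) y *\<^sub>R h i)"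
    by (simp add: blinfun.bilinear_simps algebra_simps sum.distrib scaleR_sum_right)
  ultimately show ?case using step(2) by (simp only:)
qed

lemma direct_sum:
  fixes \<phi> :: "'n::finite \<Rightarrow> ('a::real_normed_vector \<Rightarrow>\<^sub>L real)"
  assumes span: "span (\<psi> ` {1..k::nat}) = span (range \<phi>)"
    and bi: "\<And>i j. i \<in> {1..k} \<Longrightarrow> j \<in> {1..k} \<Longrightarrow> blinfun_apply (\<psi> i) (h j) = (if i = j then 1 else 0)"
  shows "\<exists>!p. p \<in> null_space (Phi \<phi>) \<times> span (h ` {1..k}) \<and> f = fst p + snd p"
proof -
  let ?s = "\<Sum>i=1..k. blinfun_apply (\<psi> i) f *\<^sub>R h i"
  have s: "?s \<in> span (h ` {1..k})"
    by (intro span_sum span_scale span_base) auto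
  have psi_s: "blinfun_apply (\<psi> j) ?s = blinfun_apply (\<psi> j) f" if "j \<in> {1..k}" for j
  proof -
    have "blinfun_apply (\<psi> j) ?s = (\<Sum>i=1..k. if i = j then blinfun_apply (\<psi> i) f else 0)"
      unfolding blinfun.sum_right blinfun.scaleR_right
      by (rule sum.cong) (use that bi in auto)
    then show ?thesis using that by simp
  qed
  have g: "f - ?s \<in> null_space (Phi \<phi>)"
    using psi_s by (simp add: null_space_Phi[OF span] blinfun.diff_right)
  show ?thesis
  proof (rule ex1I[of _ "(f - ?s, ?s)"])
    show "(f - ?s, ?s) \<in> null_space (Phi \<phi>) \<times> span (h ` {1..k}) \<and> f = fst (f - ?s, ?s) + snd (f - ?s, ?s)"
      using s g by simp
  next
    fix p assume p: "p \<in> null_space (Phi \<phi>) \<times> span (h ` {1..k}) \<and> f = fst p + snd p"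
    then have "fst p \<in> null_space (Phi \<phi>)" and hp: "snd p \<in> span (h ` {1..k})" by auto
    then have z: "blinfun_apply (\<psi> i) (snd p) = blinfun_apply (\<psi> i) f" if "i \<in> {1..k}" for i
      using p that by (simp add: null_space_Phi[OF span] blinfun.add_right)
    have "snd p = (\<Sum>i=1..k. blinfun_apply (\<psi> i) (snd p) *\<^sub>R h i)"
      by (rule span_biorthogonal[OF bi hp, symmetric])
    also have "\<dots> = ?s" by (rule sum.cong) (simp_all add: z)
    finally have snd: "snd p = ?s" .
    have "fst p = f - snd p" using p by simp
    then have "fst p = f - ?s" by (simp only: snd)
    then show "p = (f - ?s, ?s)" by (simp only: prod_eq_iff fst_conv snd_conv snd simp_thms)
  qed
qed

lemma norm0_eq:
  assumes "\<exists>!p. p \<in> N \<times> X0 \<and> f = fst p + snd p"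
    and "g \<in> N" "h \<in> X0" "f = g + h"
  shows "norm0 N X0 f = norm g + norm h"
proof -
  have "(THE p. p \<in> N \<times> X0 \<and> f = fst p + snd p) = (g, h)"
    by (rule the1_equality[OF assms(1)]) (simp add: assms(2-4))
  then show ?thesis by (simp add: norm0_def)
qed

lemma norm0_is_norm:
  assumes ds: "\<And>f. \<exists>!p. p \<in> N \<times> X0 \<and> f = fst p + snd p"
    and N: "subspace N" and X0: "subspace X0"
  shows "norm0 N X0 f \<ge> 0"
    and "norm0 N X0 f = 0 \<longleftrightarrow> f = 0"
    and "norm0 N X0 (c *\<^sub>R f) = \<bar>c\<bar> * norm0 N X0 f"
    and "norm0 N X0 (f + f') \<le> norm0 N X0 f + norm0 N X0 f'"
proof -
  obtain g h where f: "g \<in> N" "h \<in> X0" "f = g + h" using ex1_implies_ex[OF ds[of f]] by auto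
  obtain g' h' where f': "g' \<in> N" "h' \<in> X0" "f' = g' + h'" using ex1_implies_ex[OF ds[of f']] by auto
  note e = norm0_eq[OF ds f] norm0_eq[OF ds f']
  show "norm0 N X0 f \<ge> 0" by (simp add: e)
  have "norm0 N X0 0 = 0"
    using norm0_eq[OF ds, of 0 0 0] N X0 by (simp add: subspace_0)
  moreover have "norm g + norm h = 0 \<Longrightarrow> f = 0"
    by (simp add: add_nonneg_eq_0_iff f(3))
  ultimately show "norm0 N X0 f = 0 \<longleftrightarrow> f = 0" using e(1) by auto
  have "norm0 N X0 (c *\<^sub>R f) = norm (c *\<^sub>R g) + norm (c *\<^sub>R h)"
    using f N X0 by (intro norm0_eq ds) (auto simp: subspace_scale scaleR_add_right)
  then show "norm0 N X0 (c *\<^sub>R f) = \<bar>c\<bar> * norm0 N X0 f" by (simp add: e algebra_simps)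
  have "norm0 N X0 (f + f') = norm (g + g') + norm (h + h')"
    using f f' N X0 by (intro norm0_eq ds) (auto simp: subspace_add)
  then show "norm0 N X0 (f + f') \<le> norm0 N X0 f + norm0 N X0 f'"
    using norm_triangle_ineq[of g g'] norm_triangle_ineq[of h h'] by (simp add: e)
qed

end

theory Submission
  imports Defs
begin

text \<open>The range of \<open>Phi \<phi>\<close> is a finite-dimensional space, so \<open>\<xi>\<close> has an \<open>ip\<close>-orthogonal
  projection onto it (\<open>orthogonal_projection_exists\<close>), of the form \<open>Phi \<phi> f0\<close>.  By Pythagoras this
  is the only point of the range closest to \<open>\<xi>\<close>, and by definiteness it is the only one whose
  difference to \<open>\<xi>\<close> is orthogonal to the range.  Hence the least-square solutions and the
  solutions of the normal equation both coincide with the coset of \<open>f0\<close> modulo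
  \<open>null_space (Phi \<phi>)\<close> (\<open>least_square_solution_iff\<close>, \<open>normal_equation_iff\<close>).

  Since the null space and \<open>X0\<close> are complementary, this coset meets \<open>X0\<close> in exactly one point
  \<open>fd\<close>.  Every point of the coset is \<open>g + fd\<close> with \<open>g\<close> in the null space, and its \<open>norm0\<close> is
  \<open>norm g + norm fd\<close>, which is smallest for \<open>g = 0\<close> and only there
  (\<open>norm0_minimal_in_coset\<close>).\<close>

lemma
  assumes "is_inner_product ip"
  shows inner_product_add_left: "ip (u + v) w = ip u w + ip v w"
    and inner_product_add_right: "ip w (u + v) = ip w u + ip w v"
    and inner_product_diff_left: "ip (u - v) w = ip u w - ip v w"
    and inner_product_diff_right: "ip w (u - v) = ip w u - ip w v"
    and inner_product_scale_left: "ip (c *\<^sub>R u) w = c * ip u w"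
    and inner_product_scale_right: "ip w (c *\<^sub>R u) = c * ip w u"
    and inner_product_zero_left: "ip 0 w = 0"
    and inner_product_zero_right: "ip w 0 = 0"
    and inner_product_commute: "ip u w = ip w u"
    and inner_product_eq_zero: "ip u u = 0 \<longleftrightarrow> u = 0"
    and inner_product_nonneg: "ip u u \<ge> 0"
proof -
  have b: "bilinear ip" and s: "\<And>u v. ip u v = ip v u" and p: "\<And>u. u \<noteq> 0 \<Longrightarrow> ip u u > 0"
    using assms by (auto simp: is_inner_product_def)
  show "ip (u + v) w = ip u w + ip v w" "ip w (u + v) = ip w u + ip w v"
    "ip (u - v) w = ip u w - ip v w" "ip w (u - v) = ip w u - ip w v"
    "ip (c *\<^sub>R u) w = c * ip u w" "ip w (c *\<^sub>R u) = c * ip w u"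
    "ip w 0 = 0" and z: "ip 0 w = 0" for u v w c
    by (simp_all add: b bilinear_ladd bilinear_radd bilinear_lsub bilinear_rsub
        bilinear_lmul bilinear_rmul bilinear_lzero bilinear_rzero)
  show "ip u w = ip w u" by (rule s)
  show "ip u u = 0 \<longleftrightarrow> u = 0" "ip u u \<ge> 0"
    using p[of u] z by (cases "u = 0"; force)+
qed

lemmas inner_product_simps =
  inner_product_add_left inner_product_add_right inner_product_diff_left inner_product_diff_right
  inner_product_scale_left inner_product_scale_right inner_product_zero_left
  inner_product_zero_right

text \<open>A Gram-Schmidt step: the projection onto a span is corrected by the component along the part
  \<open>b'\<close> of the new vector that is orthogonal to the old span.\<close>

lemma orthogonal_projection_exists:
  assumes ip: "is_inner_product ip" and "finite B"
  shows "\<exists>y\<in>span B. \<forall>w\<in>span B. ip w (y - x) = 0"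
  using \<open>finite B\<close>
proof (induction B arbitrary: x rule: finite_induct)
  case empty
  show ?case by (simp add: inner_product_simps[OF ip])
next
  case (insert b B)
  obtain c where c: "c \<in> span B" "\<And>w. w \<in> span B \<Longrightarrow> ip w (c - b) = 0"
    using insert.IH[of b] by blast
  obtain y where y: "y \<in> span B" "\<And>w. w \<in> span B \<Longrightarrow> ip w (y - x) = 0"
    using insert.IH[of x] by blast
  define b' where "b' = b - c"
  have orth: "ip w b' = 0" if "w \<in> span B" for w
    using c(2)[OF that] by (simp add: b'_def inner_product_simps[OF ip])
  (* If b' = 0, then b lies in the span of B already; division by zero gives z = y, as it should. *)
  define z where "z = y + (ip b' x / ip b' b') *\<^sub>R b'"
  have sub: "span B \<subseteq> span (insert b B)" by (rule span_mono) auto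
  have "b' \<in> span (insert b B)"
    unfolding b'_def by (intro span_diff) (use c(1) sub in \<open>auto intro: span_base\<close>)
  then have "z \<in> span (insert b B)"
    unfolding z_def by (intro span_add span_scale) (use y(1) sub in auto)
  moreover have "ip w (z - x) = 0" if w: "w \<in> span (insert b B)" for w
  proof -
    obtain a where "w - a *\<^sub>R b \<in> span B"
      using w by (auto simp: span_insert)
    moreover define v where "v = w - a *\<^sub>R b + a *\<^sub>R c"
    ultimately have v: "v \<in> span B" using c(1) by (simp add: span_add span_scale)
    have w_eq: "w = v + a *\<^sub>R b'" by (simp add: v_def b'_def algebra_simps)
    have "ip v (z - x) = 0"
      using y(2)[OF v] orth[OF v] by (simp add: z_def inner_product_simps[OF ip])
    moreover have "ip b' (z - x) = 0"
    proof (cases "b' = 0")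
      case False
      then have "ip b' b' \<noteq> 0" by (simp add: inner_product_eq_zero[OF ip])
      moreover have "ip b' y = 0"
        using orth[OF y(1)] by (simp add: inner_product_commute[OF ip, of b' y])
      ultimately show ?thesis by (simp add: z_def inner_product_simps[OF ip])
    qed (simp add: inner_product_simps[OF ip])
    ultimately show ?thesis by (simp add: w_eq inner_product_simps[OF ip])
  qed
  ultimately show ?case by blast
qed

text \<open>Orthogonality makes \<open>T f0\<close> the projection of \<open>\<xi>\<close> onto the range of \<open>T\<close>, so Pythagoras
  splits the squared distance from \<open>T f\<close> to \<open>\<xi>\<close> into that from \<open>T f\<close> to \<open>T f0\<close> and the constant
  one from \<open>T f0\<close> to \<open>\<xi>\<close>; it is smallest exactly when the first part vanishes.\<close>

lemma least_square_solution_iff: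
  assumes ip: "is_inner_product ip" and T: "linear T"
    and orth: "\<And>f. ip (T f) (T f0 - \<xi>) = 0"
  shows "least_square_solution ip T \<xi> f \<longleftrightarrow> T f = T f0"
proof -
  have pyth: "ip (T f - \<xi>) (T f - \<xi>) = ip (T f - T f0) (T f - T f0) + ip (T f0 - \<xi>) (T f0 - \<xi>)" for f
  proof -
    have "ip (T f - T f0) (T f0 - \<xi>) = 0"
      using orth[of "f - f0"] by (simp add: linear_diff[OF T])
    then show ?thesis
      using inner_product_commute[OF ip, of "T f" "T f0"]
        inner_product_commute[OF ip, of "T f" \<xi>] inner_product_commute[OF ip, of "T f0" \<xi>]
      by (simp add: inner_product_simps[OF ip])
  qed
  have le: "norm_ip ip (T f0 - \<xi>) \<le> norm_ip ip (T f - \<xi>)" for f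
    unfolding norm_ip_def by (simp add: pyth[of f] inner_product_nonneg[OF ip])
  have "(INF h. norm_ip ip (T h - \<xi>)) = norm_ip ip (T f0 - \<xi>)"
    by (rule cInf_eq_minimum) (use le in auto)
  then have "least_square_solution ip T \<xi> f \<longleftrightarrow> ip (T f - T f0) (T f - T f0) = 0"
    by (simp add: least_square_solution_def norm_ip_def pyth[of f])
  then show ?thesis by (simp add: inner_product_eq_zero[OF ip])
qed

text \<open>The normal equation says that \<open>Phi \<phi> f - \<xi>\<close> is orthogonal to the range of \<open>Phi \<phi>\<close>.  This
  holds for \<open>f0\<close>, so for any other solution \<open>f\<close> the vector \<open>Phi \<phi> f - Phi \<phi> f0\<close> is orthogonal to
  the range and lies in it, hence is orthogonal to itself.\<close>

lemma normal_equation_iff: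
  fixes \<phi> :: "'n::finite \<Rightarrow> ('a::real_normed_vector \<Rightarrow>\<^sub>L real)"
  assumes ip: "is_inner_product ip"
    and orth: "\<And>f. ip (Phi \<phi> f) (Phi \<phi> f0 - \<xi>) = 0"
  shows "(adj_map ip (Phi \<phi>) \<circ> Phi \<phi>) f = adj_map ip (Phi \<phi>) \<xi> \<longleftrightarrow> Phi \<phi> f = Phi \<phi> f0"
proof -
  have T: "linear (Phi \<phi>)" by (simp add: bounded_linear.linear bounded_linear_Phi)
  have eq: "ip (Phi \<phi> g) \<xi> = ip (Phi \<phi> g) (Phi \<phi> f0)" for g
    using orth[of g] by (simp add: inner_product_simps[OF ip])
  have "(adj_map ip (Phi \<phi>) \<circ> Phi \<phi>) f = adj_map ip (Phi \<phi>) \<xi> \<longleftrightarrow>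
      (\<forall>g. ip (Phi \<phi> g) (Phi \<phi> f) = ip (Phi \<phi> g) (Phi \<phi> f0))"
    by (simp add: blinfun_apply_inject[symmetric] fun_eq_iff adj_map_apply[OF ip] eq)
  also have "\<dots> \<longleftrightarrow> Phi \<phi> f = Phi \<phi> f0"
  proof
    assume "\<forall>g. ip (Phi \<phi> g) (Phi \<phi> f) = ip (Phi \<phi> g) (Phi \<phi> f0)"
    then have "ip (Phi \<phi> (f - f0)) (Phi \<phi> f - Phi \<phi> f0) = 0"
      by (simp add: inner_product_simps[OF ip])
    then show "Phi \<phi> f = Phi \<phi> f0"
      by (simp add: linear_diff[OF T] inner_product_eq_zero[OF ip])
  qed simp
  finally show ?thesis .
qed

text \<open>Points of the coset of \<open>fd\<close> differ only in their \<open>N\<close>-component, which is \<open>0\<close> for \<open>fd\<close>.\<close>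

lemma norm0_minimal_in_coset:
  assumes ds: "\<And>f. \<exists>!p. p \<in> N \<times> X0 \<and> f = fst p + snd p"
    and "0 \<in> N" "fd \<in> X0" "f - fd \<in> N"
  shows "norm0 N X0 fd \<le> norm0 N X0 f"
    and "norm0 N X0 f = norm0 N X0 fd \<Longrightarrow> f = fd"
proof -
  have "norm0 N X0 fd = norm fd"
    using norm0_eq[OF ds \<open>0 \<in> N\<close> \<open>fd \<in> X0\<close>] by simp
  moreover have "norm0 N X0 f = norm (f - fd) + norm fd"
    by (rule norm0_eq[OF ds]) (use assms in auto)
  ultimately show "norm0 N X0 fd \<le> norm0 N X0 f" "norm0 N X0 f = norm0 N X0 fd \<Longrightarrow> f = fd"
    by simp_all
qed

theorem theorem4p3:
  fixes \<phi> :: "'n::finite \<Rightarrow> ('a::real_normed_vector \<Rightarrow>\<^sub>L real)"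
    and ip :: "real ^ 'n \<Rightarrow> real ^ 'n \<Rightarrow> real"
    and k :: nat
    and \<psi> :: "nat \<Rightarrow> ('a \<Rightarrow>\<^sub>L real)"
    and h :: "nat \<Rightarrow> 'a"
    and X0 :: "'a set"
    and \<xi> :: "real ^ 'n"
  assumes "is_inner_product ip"
    and "inj_on \<psi> {1..k}" and "independent (\<psi> ` {1..k})"
    and "span (\<psi> ` {1..k}) = span (range \<phi>)"
    and "\<And>i j. i \<in> {1..k} \<Longrightarrow> j \<in> {1..k} \<Longrightarrow>
           blinfun_apply (\<psi> i) (h j) = (if i = j then 1 else 0)"
    and "X0 = span (h ` {1..k})"
  shows "\<exists>fd\<in>X0.
    least_square_solution ip (Phi \<phi>) \<xi> fd \<and>
    (\<forall>f\<in>X0. least_square_solution ip (Phi \<phi>) \<xi> f \<longrightarrow> f = fd) \<and>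
    (adj_map ip (Phi \<phi>) \<circ> Phi \<phi>) fd = adj_map ip (Phi \<phi>) \<xi> \<and>
    (\<forall>f\<in>X0. (adj_map ip (Phi \<phi>) \<circ> Phi \<phi>) f = adj_map ip (Phi \<phi>) \<xi> \<longrightarrow> f = fd) \<and>
    norm0 (null_space (Phi \<phi>)) X0 fd =
      Inf {norm0 (null_space (Phi \<phi>)) X0 f |f.
             (adj_map ip (Phi \<phi>) \<circ> Phi \<phi>) f = adj_map ip (Phi \<phi>) \<xi>} \<and>
    (\<forall>f. least_square_solution ip (Phi \<phi>) \<xi> f \<and>
         norm0 (null_space (Phi \<phi>)) X0 f =
           Inf {norm0 (null_space (Phi \<phi>)) X0 f' |f'.
                  (adj_map ip (Phi \<phi>) \<circ> Phi \<phi>) f' = adj_map ip (Phi \<phi>) \<xi>}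
         \<longrightarrow> f = fd)"
proof -
  let ?T = "Phi \<phi>" and ?N = "null_space (Phi \<phi>)"
  note ip = assms(1)
  have T: "linear ?T" by (simp add: bounded_linear.linear bounded_linear_Phi)
  have ds: "\<exists>!p. p \<in> ?N \<times> X0 \<and> f = fst p + snd p" for f
    unfolding assms(6) by (rule direct_sum[OF assms(4,5)])
  have N_iff: "f - f' \<in> ?N \<longleftrightarrow> ?T f = ?T f'" for f f'
    by (simp add: null_space_def linear_diff[OF T])
  have zero: "0 \<in> ?N" by (simp add: null_space_def linear_0[OF T])

  obtain B where B: "B \<subseteq> range ?T" "independent B" "range ?T \<subseteq> span B"
    using basis_exists[of "range ?T"] by metis
  have "subspace (range ?T)" by (rule linear_subspace_image[OF T subspace_UNIV])
  then have span_B: "span B = range ?T" using B span_minimal by blast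
  have "finite B" using B(2) by (rule independent_imp_finite)
  then obtain f0 where f0: "\<And>f. ip (?T f) (?T f0 - \<xi>) = 0"
    using orthogonal_projection_exists[OF ip, of B \<xi>] by (auto simp: span_B)

  obtain g fd where fd: "g \<in> ?N" "fd \<in> X0" "f0 = g + fd"
    using ex1_implies_ex[OF ds[of f0]] by auto
  have T_fd: "?T f0 = ?T fd"
    using fd N_iff[of f0 fd] by simp
  have orth: "ip (?T f) (?T fd - \<xi>) = 0" for f
    using f0[of f] by (simp add: T_fd)
  note ls = least_square_solution_iff[OF ip T orth]
  note ne = normal_equation_iff[OF ip orth]
  have uniq: "f = fd" if "f \<in> X0" "?T f = ?T fd" for f
  proof -
    have "(THE p. p \<in> ?N \<times> X0 \<and> f = fst p + snd p) = (0, f)"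
      by (rule the1_equality[OF ds]) (use that(1) zero in simp)
    moreover have "(THE p. p \<in> ?N \<times> X0 \<and> f = fst p + snd p) = (f - fd, fd)"
      by (rule the1_equality[OF ds]) (use that(2) fd(2) N_iff in simp)
    ultimately have "(0, f) = (f - fd, fd)" by (rule trans[OF sym])
    then show ?thesis by simp
  qed
  note min = norm0_minimal_in_coset[OF ds zero fd(2)]
  have inf: "Inf {norm0 ?N X0 f |f. ?T f = ?T fd} = norm0 ?N X0 fd"
    by (rule cInf_eq_minimum) (use min(1) N_iff in auto)
  show ?thesis
    unfolding ls ne inf
    by (rule bexI[OF _ fd(2)]) (use uniq min(2) N_iff in auto)
qed

end
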